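(* Let $A$ be an $n\times n$ real symmetric random matrix in which the entries $\{A_{i,j}\}_{1\le i\le j\le n}$ are independent and have continuous distributions with densities bounded by $K$. Then for all $t>0$, $$\mathbb{P}\left\{ \|A^{-1}\| \ge n^2 t \right\}\le \frac{8K}{t}.$$
   Context: $\|\cdot\|$ denotes the spectral (operator) norm of a matrix, i.e. the operator norm with respect to the Euclidean norm. "Continuous distribution with density bounded by $K$" means that the law of the real random variable $A_{i,j}$ is absolutely continuous with respect to Lebesgue measure on $\mathbb{R}$ with a density bounded above by $K$; the same constant $K$ serves for all entries, but the entries need not be identically distributed, need not have mean zero, and no moment assumptions are made. Symmetric means $A_{j,i}=A_{i,j}$ for all $i,j$. Since the law of the entries on and above the diagonal is absolutely continuous, $A$ is invertible almost surely, so $A^{-1}$ is defined almost surely. *)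

theory Defs
  imports "HOL-Probability.Probability"
begin

text \<open>
  The dimension \<open>n\<close> is \<open>CARD('n)\<close> for a finite linearly ordered index type \<open>'n\<close>; the order serves
  to single out the entries on and above the diagonal.  The spectral norm of \<open>B\<close> is
  \<open>onorm ((*v) B)\<close>, as \<open>norm\<close> on \<^typ>\<open>real ^ 'n\<close> is the Euclidean norm, whereas \<open>norm B\<close> itself
  would be the Frobenius norm.  \<^const>\<open>matrix_inv\<close> has one fixed unspecified value on all singular
  matrices.
\<close>

definition has_density_bounded_by :: "'a measure \<Rightarrow> ('a \<Rightarrow> real) \<Rightarrow> real \<Rightarrow> bool" where
  "has_density_bounded_by M X K \<longleftrightarrow>
     (\<exists>f. distributed M lborel X f \<and> (\<forall>x. f x \<le> ennreal K))"

end

theory Submission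
  imports Defs
begin

text \<open>
  Fix all entries except \<open>x = A\<^sub>i\<^sub>j\<close>.  If the matrix is invertible at some base point \<open>x'\<close>, with
  inverse \<open>B\<close>, then the \<open>(i, j)\<close> entry of the inverse at \<open>x' + h\<close> is
  \<open>(q - h D) / ((1 + h q)\<^sup>2 - h\<^sup>2 p r)\<close> where \<open>p = B\<^sub>i\<^sub>i\<close>, \<open>q = B\<^sub>i\<^sub>j\<close>, \<open>r = B\<^sub>j\<^sub>j\<close>,
  \<open>D = p r - q\<^sup>2\<close>, with \<open>p r\<close> replaced by \<open>0\<close> when \<open>i = j\<close>.  Up to a shift of \<open>h\<close> this is \<open>w / (w\<^sup>2 - d)\<close> in absolute value, which exceeds \<open>u\<close> on at
  most two intervals of length \<open>1 / u\<close>.  Hence every entry of the inverse has the tail bound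
  \<open>2 K / u\<close>.  Such a tail gives each entry truncated at \<open>c\<close> a second moment of at most
  \<open>4 K c\<close>, and Markov's inequality for the sum of the \<open>n\<^sup>2\<close> truncated squares with
  \<open>c = n\<^sup>2 t\<close> bounds the probability that the Frobenius norm of the inverse reaches \<open>c\<close> by
  \<open>4 K / t\<close>.  Almost sure invertibility follows by adding one row at a time, since the
  determinant is affine in a diagonal entry with the smaller principal minor as slope.
\<close>

section \<open>Probability: slicing along one coordinate, and moments from tails\<close>

text \<open>By independence the joint law is a product, so Fubini integrates coordinate
  \<open>k\<close> first, and its density is at most \<open>K\<close> on each section. As
  \<open>g\<close> ranges over arbitrary functions, sections are only asked to have a measurable
  cover \<open>V\<close>.\<close>

lemma (in prob_space) indep_vars_section_bound:
  fixes X :: "'i \<Rightarrow> 'a \<Rightarrow> real"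
  assumes ind: "indep_vars (\<lambda>_. borel) X I" and "finite I" "k \<in> I"
    and dens: "has_density_bounded_by M (X k) K"
    and Q: "Measurable.pred (PiM I (\<lambda>_. borel)) Q"
    and sec: "\<And>g. \<exists>V\<in>sets lborel. {y. Q (g(k := y))} \<subseteq> V \<and> emeasure lborel V \<le> c"
  shows "emeasure M {\<omega> \<in> space M. Q (\<lambda>i\<in>I. X i \<omega>)} \<le> ennreal K * c"
proof -
  obtain f where f: "distributed M lborel (X k) f" and fK: "\<And>x. f x \<le> ennreal K"
    using dens unfolding has_density_bounded_by_def by auto
  have rv: "X i \<in> borel_measurable M" if "i \<in> I" for i
    using ind that unfolding indep_vars_def by simp
  \<comment> \<open>Point masses at 0 fill the indices outside \<open>I\<close>, because
    \<open>product_prob_space\<close> wants a probability measure at every index.\<close>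
  define N where "N i = (if i \<in> I then distr M borel (X i) else return borel 0)" for i
  have [simp]: "sets (N i) = sets borel" for i by (simp add: N_def)
  have pN: "prob_space (N i)" for i
    unfolding N_def by (auto intro: prob_space_distr rv prob_space_return)
  interpret N: product_prob_space N UNIV
    using pN by (auto simp: product_prob_space_def product_prob_space_axioms_def
        product_sigma_finite_def prob_space_imp_sigma_finite)
  define J where "J = I - {k}"
  have J: "finite J" "k \<notin> J" "insert k J = I"
    using assms(2,3) by (auto simp: J_def)
  have [measurable]: "(\<lambda>x. \<lambda>i\<in>I. X i x) \<in> measurable M (PiM I (\<lambda>_. borel))"
    by (intro measurable_restrict rv)
  have setsN: "sets (PiM I N) = sets (PiM I (\<lambda>_. borel))"
    by (intro sets_PiM_cong) auto
  note Q[measurable]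
  have D: "distr M (PiM I (\<lambda>_. borel)) (\<lambda>x. \<lambda>i\<in>I. X i x) = PiM I N"
    using ind assms(3) indep_vars_iff_distr_eq_PiM'[of I X "\<lambda>_. borel"] rv
    by (auto simp: N_def cong: PiM_cong)
  have QN: "Measurable.pred (PiM I N) Q"
    using Q by (simp add: measurable_cong_sets[OF setsN refl])
  have "emeasure M {\<omega> \<in> space M. Q (\<lambda>i\<in>I. X i \<omega>)}
      = emeasure (distr M (PiM I (\<lambda>_. borel)) (\<lambda>x. \<lambda>i\<in>I. X i x)) {g \<in> space (PiM I (\<lambda>_. borel)). Q g}"
  proof -
    have "{g \<in> space (PiM I (\<lambda>_. borel)). Q g} \<in> sets (PiM I (\<lambda>_. borel))"
      by measurable
    then show ?thesis
      by (subst emeasure_distr) (auto intro!: arg_cong[where f="emeasure M"] simp: space_PiM)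
  qed
  also have "\<dots> = emeasure (PiM I N) {g \<in> space (PiM I N). Q g}"
    unfolding D by (simp add: sets_eq_imp_space_eq[OF setsN])
  also have "\<dots> = (\<integral>\<^sup>+g. indicator {g. Q g} g \<partial>PiM I N)"
  proof -
    have "{g \<in> space (PiM I N). Q g} \<in> sets (PiM I N)"
      using QN by measurable
    then have "emeasure (PiM I N) {g \<in> space (PiM I N). Q g}
        = (\<integral>\<^sup>+g. indicator {g \<in> space (PiM I N). Q g} g \<partial>PiM I N)"
      by simp
    then show ?thesis by (simp cong: nn_integral_cong_simp add: indicator_def)
  qed
  also have "\<dots> = (\<integral>\<^sup>+g. (\<integral>\<^sup>+y. indicator {g. Q g} (g(k := y)) \<partial>N k) \<partial>PiM J N)"
    using QN by (subst J(3)[symmetric], subst N.product_nn_integral_insert) (auto simp: J)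
  also have "\<dots> \<le> (\<integral>\<^sup>+g. ennreal K * c \<partial>PiM J N)"
  proof (rule nn_integral_mono)
    fix g
    obtain V where V: "V \<in> sets borel" "{y. Q (g(k := y))} \<subseteq> V" "emeasure lborel V \<le> c"
      using sec[of g] by auto
    have fm: "f \<in> borel_measurable lborel"
      using f by (rule distributed_borel_measurable)
    have Nk: "N k = density lborel f"
      using f assms(3) unfolding N_def distributed_def by (simp cong: distr_cong)
    have "(\<integral>\<^sup>+y. indicator {g. Q g} (g(k := y)) \<partial>N k) \<le> (\<integral>\<^sup>+y. indicator V y \<partial>N k)"
      using V(2) by (intro nn_integral_mono) (auto split: split_indicator)
    also have "\<dots> = (\<integral>\<^sup>+y. f y * indicator V y \<partial>lborel)"
      using V(1) fm by (simp add: Nk emeasure_density)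
    also have "\<dots> \<le> (\<integral>\<^sup>+y. ennreal K * indicator V y \<partial>lborel)"
      by (intro nn_integral_mono mult_right_mono fK) auto
    also have "\<dots> = ennreal K * emeasure lborel V"
      using V(1) by (simp add: nn_integral_cmult_indicator)
    also have "\<dots> \<le> ennreal K * c"
      by (intro mult_left_mono V) auto
    finally show "(\<integral>\<^sup>+y. indicator {g. Q g} (g(k := y)) \<partial>N k) \<le> ennreal K * c" .
  qed
  also have "\<dots> = ennreal K * c"
    using prob_space.emeasure_space_1[OF prob_space_PiM[of J N]] pN by simp
  finally show ?thesis .
qed

text \<open>\<open>ennreal\<close> sends nonpositive reals to 0, so a bound \<open>K \<le> 0\<close>
  would force the zero density, whose total mass is not 1.\<close>

lemma (in prob_space) density_bound_pos:
  assumes "has_density_bounded_by M X K"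
  shows "0 < K"
proof (rule ccontr)
  assume "\<not> 0 < K"
  then have K: "ennreal K = 0" by (simp add: ennreal_neg)
  obtain f where f: "distributed M lborel X f" and fK: "\<And>x. f x \<le> 0"
    using assms K unfolding has_density_bounded_by_def by auto
  have "prob_space (density lborel f)"
    using f unfolding distributed_def by (metis prob_space_distr)
  then have "emeasure (density lborel f) (space (density lborel f)) = 1"
    by (rule prob_space.emeasure_space_1)
  moreover have "f = (\<lambda>_. 0)" using fK by auto
  ultimately show False by (simp add: emeasure_density)
qed

text \<open>Layer cake: the square is the integral of \<open>2 * u\<close> over
  \<open>{0..min (Y \<omega>) r}\<close>. After Tonelli the tail \<open>C / u\<close> cancels the
  factor \<open>u\<close>, leaving the constant \<open>2 * C\<close> on \<open>{0..r}\<close>.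
  Without truncation such a tail allows an infinite second moment.\<close>

lemma (in prob_space) truncated_second_moment_le:
  fixes Y :: "'a \<Rightarrow> real"
  assumes [measurable]: "Y \<in> borel_measurable M" and nn: "\<And>\<omega>. 0 \<le> Y \<omega>" and "0 \<le> C" "0 < r"
    and tail: "\<And>u. 0 < u \<Longrightarrow> emeasure M {\<omega> \<in> space M. u \<le> Y \<omega>} \<le> ennreal (C / u)"
  shows "(\<integral>\<^sup>+\<omega>. ennreal ((min (Y \<omega>) r)\<^sup>2) \<partial>M) \<le> ennreal (2 * C * r)"
proof -
  interpret PS: pair_sigma_finite M lborel ..
  have "(\<integral>\<^sup>+\<omega>. ennreal ((min (Y \<omega>) r)\<^sup>2) \<partial>M)
      = (\<integral>\<^sup>+\<omega>. (\<integral>\<^sup>+u. ennreal (2 * u) * indicator {0..min (Y \<omega>) r} u \<partial>lborel) \<partial>M)"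
    using nn \<open>0 < r\<close>
    by (intro nn_integral_cong, subst nn_integral_FTC_Icc[where F="\<lambda>u. u\<^sup>2"])
       (auto intro!: derivative_eq_intros)
  also have "\<dots> = (\<integral>\<^sup>+\<omega>. (\<integral>\<^sup>+u. ennreal (2 * u) * indicator {0..r} u * (if u \<le> Y \<omega> then 1 else 0) \<partial>lborel) \<partial>M)"
    by (intro nn_integral_cong) (auto split: split_indicator)
  also have "\<dots> = (\<integral>\<^sup>+u. (\<integral>\<^sup>+\<omega>. ennreal (2 * u) * indicator {0..r} u * (if u \<le> Y \<omega> then 1 else 0) \<partial>M) \<partial>lborel)"
    by (rule PS.Fubini'[symmetric]) measurable
  also have "\<dots> = (\<integral>\<^sup>+u. ennreal (2 * u) * indicator {0..r} u * emeasure M {\<omega> \<in> space M. u \<le> Y \<omega>} \<partial>lborel)"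
  proof (rule nn_integral_cong)
    fix u
    have "(\<integral>\<^sup>+\<omega>. (if u \<le> Y \<omega> then 1 else 0) \<partial>M) = (\<integral>\<^sup>+\<omega>. indicator {\<omega> \<in> space M. u \<le> Y \<omega>} \<omega> \<partial>M)"
      by (intro nn_integral_cong) (auto simp: indicator_def)
    also have "\<dots> = emeasure M {\<omega> \<in> space M. u \<le> Y \<omega>}"
      by (intro nn_integral_indicator) measurable
    finally show "(\<integral>\<^sup>+\<omega>. ennreal (2 * u) * indicator {0..r} u * (if u \<le> Y \<omega> then 1 else 0) \<partial>M)
        = ennreal (2 * u) * indicator {0..r} u * emeasure M {\<omega> \<in> space M. u \<le> Y \<omega>}"
      by (subst nn_integral_cmult) auto
  qed
  also have "\<dots> \<le> (\<integral>\<^sup>+u. ennreal (2 * C) * indicator {0..r} u \<partial>lborel)"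
  proof (rule nn_integral_mono)
    fix u :: real
    show "ennreal (2 * u) * indicator {0..r} u * emeasure M {\<omega> \<in> space M. u \<le> Y \<omega>}
        \<le> ennreal (2 * C) * indicator {0..r} u"
    proof (cases "0 < u")
      case True
      then have "ennreal (2 * u) * emeasure M {\<omega> \<in> space M. u \<le> Y \<omega>} \<le> ennreal (2 * u) * ennreal (C / u)"
        by (intro mult_left_mono tail) auto
      also have "\<dots> = ennreal (2 * C)"
        using True by (subst ennreal_mult[symmetric]) (use \<open>0 \<le> C\<close> in \<open>auto simp: field_simps\<close>)
      finally show ?thesis by (auto split: split_indicator)
    next
      case False
      then have "ennreal (2 * u) = 0" by (simp add: ennreal_neg)
      then show ?thesis by simp
    qed
  qed
  also have "\<dots> = ennreal (2 * C * r)"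
    using \<open>0 \<le> C\<close> \<open>0 < r\<close> by (simp add: nn_integral_cmult_indicator ennreal_mult)
  finally show ?thesis .
qed

section \<open>Covering the exceptional values of one entry by short intervals\<close>

lemma diameter_le_imp_interval:
  fixes S :: "real set"
  assumes "\<And>x y. x \<in> S \<Longrightarrow> y \<in> S \<Longrightarrow> x \<le> y \<Longrightarrow> y - x \<le> c"
  shows "\<exists>a. S \<subseteq> {a..a + c}"
proof (cases "S = {}")
  case False
  then obtain x0 where x0: "x0 \<in> S" by auto
  have lb: "x0 - \<bar>c\<bar> \<le> x" if "x \<in> S" for x
    using assms[OF that x0] by (cases "x \<le> x0") auto
  then have bdd: "bdd_below S" by (auto simp: bdd_below_def)
  have "x \<le> Inf S + c" if "x \<in> S" for x
  proof -
    have "x - c \<le> Inf S"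
    proof (rule cInf_greatest[OF False])
      fix y assume "y \<in> S"
      show "x - c \<le> y"
        \<comment> \<open>The pair \<open>(x, x)\<close> yields \<open>0 \<le> c\<close>, which
          settles the case \<open>x < y\<close>.\<close>
        using assms[OF \<open>y \<in> S\<close> that] assms[OF that that] by (cases "y \<le> x") auto
    qed
    then show ?thesis by simp
  qed
  then have "S \<subseteq> {Inf S..Inf S + c}"
    using cInf_lower[OF _ bdd] by auto
  then show ?thesis by blast
qed auto

text \<open>For \<open>x \<le> y\<close> in the set, adding \<open>u * (d - x^2) \<le> x\<close> and
  \<open>u * (y^2 - d) \<le> y\<close> eliminates \<open>d\<close>; the common factor
  \<open>x + y\<close> then cancels. The sign of \<open>d\<close> never enters.\<close>

lemma nonneg_part_interval:
  fixes u d :: real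
  assumes "0 < u"
  shows "\<exists>a. {w. 0 \<le> w \<and> u * \<bar>w\<^sup>2 - d\<bar> \<le> w} \<subseteq> {a..a + 1 / u}"
proof (rule diameter_le_imp_interval)
  fix x y assume "x \<in> {w. 0 \<le> w \<and> u * \<bar>w\<^sup>2 - d\<bar> \<le> w}" "y \<in> {w. 0 \<le> w \<and> u * \<bar>w\<^sup>2 - d\<bar> \<le> w}" "x \<le> y"
  then have *: "0 \<le> x" "u * \<bar>x\<^sup>2 - d\<bar> \<le> x" "u * \<bar>y\<^sup>2 - d\<bar> \<le> y" "x \<le> y" by auto
  have "u * (d - x\<^sup>2) \<le> x" "u * (y\<^sup>2 - d) \<le> y"
    using *(2,3) \<open>0 < u\<close> mult_left_mono[of "d - x\<^sup>2" "\<bar>x\<^sup>2 - d\<bar>" u]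
      mult_left_mono[of "y\<^sup>2 - d" "\<bar>y\<^sup>2 - d\<bar>" u] by linarith+
  then have le: "u * (y - x) * (x + y) \<le> 1 * (x + y)"
    by (simp add: algebra_simps power2_eq_square)
  show "y - x \<le> 1 / u"
  proof (cases "0 < x + y")
    case True
    with le have "u * (y - x) \<le> 1" by (rule mult_right_le_imp_le)
    then show ?thesis using \<open>0 < u\<close> by (simp add: field_simps)
  next
    case False
    then have "x = y" using *(1,4) by simp
    then show ?thesis using \<open>0 < u\<close> by simp
  qed
qed

text \<open>For \<open>d > 0\<close> the map \<open>w \<mapsto> w - d / w\<close> preserves Lebesgue measure (Boole), which makes the
  constant \<open>2 / u\<close> exact.\<close>

lemma two_intervals:
  fixes u d e :: real
  assumes "0 < u"
  shows "\<exists>a b. {h. u * \<bar>(h - e)\<^sup>2 - d\<bar> \<le> \<bar>h - e\<bar>} \<subseteq> {a..a + 1 / u} \<union> {b..b + 1 / u}"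
proof -
  obtain a where a: "{w. 0 \<le> w \<and> u * \<bar>w\<^sup>2 - d\<bar> \<le> w} \<subseteq> {a..a + 1 / u}"
    using nonneg_part_interval[OF assms] by blast
  \<comment> \<open>The condition is even in \<open>h - e\<close>, so the part below
    \<open>e\<close> lies in the mirror image about \<open>e\<close> of the interval covering the
    part above.\<close>
  have "h \<in> {a + e..a + e + 1 / u} \<union> {e - a - 1 / u..e - a - 1 / u + 1 / u}"
    if h: "u * \<bar>(h - e)\<^sup>2 - d\<bar> \<le> \<bar>h - e\<bar>" for h
  proof (cases "e \<le> h")
    case True
    then have "h - e \<in> {a..a + 1 / u}" using h by (intro subsetD[OF a]) auto
    then show ?thesis by auto
  next
    case False
    then have "e - h \<in> {a..a + 1 / u}"
      using h by (intro subsetD[OF a]) (auto simp: power2_commute)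
    then show ?thesis by auto
  qed
  then show ?thesis by blast
qed

text \<open>With \<open>D = p * r - q^2\<close> nonzero, completing the square at
  \<open>h = q / D\<close> and dividing by \<open>D\<close> reduces to \<open>two_intervals\<close>.
  If \<open>D = 0\<close>, the quadratic collapses to \<open>1 + 2 * h * q\<close>, and one interval
  centred at its root suffices.\<close>

lemma fractional_linear_intervals:
  fixes p q r u :: real
  assumes "0 < u"
  shows "\<exists>a b. {h. u * \<bar>(1 + h * q)\<^sup>2 - h\<^sup>2 * (p * r)\<bar> \<le> \<bar>q - h * (p * r - q\<^sup>2)\<bar>}
    \<subseteq> {a..a + 1 / u} \<union> {b..b + 1 / u}"
proof (cases "p * r = q\<^sup>2")
  case True
  have "h \<in> {- (1 / (2 * q)) - 1 / (2 * u)..- (1 / (2 * q)) - 1 / (2 * u) + 1 / u}"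
    if h: "u * \<bar>(1 + h * q)\<^sup>2 - h\<^sup>2 * (p * r)\<bar> \<le> \<bar>q - h * (p * r - q\<^sup>2)\<bar>" for h
  proof -
    have eq: "(1 + h * q)\<^sup>2 - h\<^sup>2 * (p * r) = 1 + 2 * h * q"
      by (simp add: True power2_eq_square algebra_simps)
    have 1: "u * \<bar>1 + 2 * h * q\<bar> \<le> \<bar>q\<bar>"
      using h unfolding eq by (simp add: True)
    \<comment> \<open>For \<open>q = 0\<close> the inequality would read \<open>u \<le> 0\<close>,
      so the set is empty and the centre is harmless.\<close>
    then have "q \<noteq> 0" using \<open>0 < u\<close> by auto
    have "2 * u * \<bar>h + 1 / (2 * q)\<bar> * \<bar>q\<bar> = u * \<bar>1 + 2 * h * q\<bar>"
    proof -
      have "1 + 2 * h * q = 2 * (q * (h + 1 / (2 * q)))"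
        using \<open>q \<noteq> 0\<close> by (simp add: field_simps)
      then show ?thesis by (simp only: abs_mult abs_numeral) simp
    qed
    with 1 have "2 * u * \<bar>h + 1 / (2 * q)\<bar> * \<bar>q\<bar> \<le> 1 * \<bar>q\<bar>" by linarith
    then have "2 * u * \<bar>h + 1 / (2 * q)\<bar> \<le> 1"
      using \<open>q \<noteq> 0\<close> by (subst (asm) mult_le_cancel_right) auto
    then have "\<bar>h + 1 / (2 * q)\<bar> \<le> 1 / (2 * u)" using \<open>0 < u\<close> by (simp add: field_simps)
    moreover have "1 / u = 1 / (2 * u) + 1 / (2 * u)" by simp
    ultimately show ?thesis by (auto simp: abs_le_iff simp del: divide_divide_eq_right)
  qed
  then show ?thesis by blast
next
  case False
  define D where "D = p * r - q\<^sup>2"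
  have D: "D \<noteq> 0" "p * r = D + q\<^sup>2" using False by (auto simp: D_def)
  have "{h. u * \<bar>(1 + h * q)\<^sup>2 - h\<^sup>2 * (p * r)\<bar> \<le> \<bar>q - h * (p * r - q\<^sup>2)\<bar>}
      \<subseteq> {h. u * \<bar>(h - q / D)\<^sup>2 - p * r / D\<^sup>2\<bar> \<le> \<bar>h - q / D\<bar>}"
  proof safe
    fix h assume h: "u * \<bar>(1 + h * q)\<^sup>2 - h\<^sup>2 * (p * r)\<bar> \<le> \<bar>q - h * (p * r - q\<^sup>2)\<bar>"
    have "(1 + h * q)\<^sup>2 - h\<^sup>2 * (p * r) = - D * ((h - q / D)\<^sup>2 - p * r / D\<^sup>2)"
      using D(1) unfolding D(2) by (simp add: field_simps power2_eq_square)
    moreover have "q - h * (p * r - q\<^sup>2) = - D * (h - q / D)"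
      using D by (simp add: field_simps)
    ultimately have "\<bar>D\<bar> * (u * \<bar>(h - q / D)\<^sup>2 - p * r / D\<^sup>2\<bar>) \<le> \<bar>D\<bar> * \<bar>h - q / D\<bar>"
      using h by (simp add: abs_mult mult_ac)
    then show "u * \<bar>(h - q / D)\<^sup>2 - p * r / D\<^sup>2\<bar> \<le> \<bar>h - q / D\<bar>"
      using D(1) by (subst (asm) mult_le_cancel_left_pos) auto
  qed
  then show ?thesis using two_intervals[OF assms, of "q / D" "p * r / D\<^sup>2"] by fast
qed

section \<open>Entries of the inverse by Cramer's rule\<close>

text \<open>As a quotient of determinants this is visibly measurable. Division by zero makes it 0 on
  singular matrices, so an absolute value of at least \<open>u > 0\<close> forces
  invertibility.\<close>

definition inv_entry :: "real^'n^'n \<Rightarrow> 'n \<Rightarrow> 'n \<Rightarrow> real" where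
  "inv_entry A i j = det (\<chi> k l. if l = i then axis j 1 $ k else A $ k $ l) / det A"

lemma matrix_mult_inv_entry_column:
  assumes "det A \<noteq> 0"
  shows "A *v (\<chi> i. inv_entry A i j) = axis j 1"
  unfolding inv_entry_def by (rule iffD2[OF cramer[OF assms] refl])

lemma matrix_inv_eq_inv_entry:
  fixes A :: "real^'n^'n"
  assumes "det A \<noteq> 0"
  shows "matrix_inv A $ i $ j = inv_entry A i j"
proof -
  have "A ** matrix_inv A = mat 1"
    using assms unfolding invertible_det_nz[symmetric] invertible_def matrix_inv_def
    by (rule someI_ex[THEN conjunct1])
  then have "A *v column j (matrix_inv A) = axis j 1"
    unfolding matrix_mult_sum[symmetric]
    by (simp add: vec_eq_iff matrix_matrix_mult_def matrix_vector_mult_def column_def mat_def axis_def)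
  then have "column j (matrix_inv A) = (\<chi> i. inv_entry A i j)"
    unfolding inv_entry_def by (rule iffD1[OF cramer[OF assms]])
  then show ?thesis by (simp add: column_def vec_eq_iff)
qed

lemma inner_symmetric_matrix:
  fixes A :: "real^'n^'n"
  assumes "transpose A = A"
  shows "inner x (A *v y) = inner (A *v x) y"
  using dot_lmul_matrix[of x A y] vector_transpose_matrix[of x A] by (simp add: assms)

section \<open>Symmetric matrices as functions of their upper triangle\<close>

text \<open>Only coordinates \<open>(i, j)\<close> with \<open>i \<le> j\<close> are read, so every
  \<open>g\<close> gives a symmetric matrix and updating one independent coordinate keeps it
  symmetric.\<close>

definition sym_mat :: "('n \<times> 'n \<Rightarrow> real) \<Rightarrow> real ^ ('n :: {finite, linorder}) ^ ('n :: {finite, linorder})" where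
  "sym_mat g = (\<chi> i j. g (min i j, max i j))"

lemma transpose_sym_mat: "transpose (sym_mat g) = sym_mat g"
  by (simp add: sym_mat_def transpose_def vec_eq_iff min.commute max.commute)

lemma sym_mat_fun_upd:
  "sym_mat (g((min i j, max i j) := x)) $ k $ l =
     (if k = i \<and> l = j \<or> k = j \<and> l = i then x else sym_mat g $ k $ l)"
proof -
  have "min k l = min i j \<and> max k l = max i j \<longleftrightarrow> k = i \<and> l = j \<or> k = j \<and> l = i"
    by (metis max.commute max_def min.commute min_def)
  then show ?thesis by (simp add: sym_mat_def)
qed

text \<open>Changing one coordinate is a perturbation of rank at most two off the diagonal, and at
  most one on it.\<close>

lemma sym_mat_fun_upd_mult:
  fixes g :: "'n :: {finite, linorder} \<times> 'n \<Rightarrow> real" and i j :: 'n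
  defines "S x \<equiv> sym_mat (g((min i j, max i j) := x))"
  shows "S x *v y = S x' *v y + (x - x') *\<^sub>R
    (if i = j then y $ i *\<^sub>R axis i 1 else y $ j *\<^sub>R axis i 1 + y $ i *\<^sub>R axis j 1)"
proof (subst vec_eq_iff, rule allI)
  fix k
  have S: "S x $ k $ l = S x' $ k $ l
      + (x - x') * (if k = i \<and> l = j \<or> k = j \<and> l = i then 1 else 0)" for l
    by (simp add: S_def sym_mat_fun_upd)
  have "(S x *v y) $ k = (\<Sum>l\<in>UNIV. S x' $ k $ l * y $ l
      + (x - x') * ((if k = i \<and> l = j \<or> k = j \<and> l = i then 1 else 0) * y $ l))"
    unfolding matrix_vector_mult_def vec_lambda_beta
    by (intro sum.cong refl) (subst S, simp add: algebra_simps)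
  also have "\<dots> = (S x' *v y) $ k
      + (x - x') * (\<Sum>l\<in>UNIV. if k = i \<and> l = j \<or> k = j \<and> l = i then y $ l else 0)"
    by (simp add: sum.distrib matrix_vector_mult_def sum_distrib_left) 
       (auto intro!: sum.cong)
  also have "(\<Sum>l\<in>UNIV. if k = i \<and> l = j \<or> k = j \<and> l = i then y $ l else 0)
      = (if i = j then y $ i *\<^sub>R axis i 1 else y $ j *\<^sub>R axis i 1 + y $ i *\<^sub>R axis j 1) $ k"
    by (cases "k = i"; cases "k = j") (auto simp: axis_def)
  finally show "(S x *v y) $ k = (S x' *v y + (x - x') *\<^sub>R
      (if i = j then y $ i *\<^sub>R axis i 1 else y $ j *\<^sub>R axis i 1 + y $ i *\<^sub>R axis j 1)) $ k"
    by (simp only: vector_add_component vector_scaleR_component real_scaleR_def)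
qed

text \<open>Pairing the perturbed equation for column \<open>y\<close> of the new inverse with the
  columns \<open>b i\<close>, \<open>b j\<close> of the old one gives a linear system in
  \<open>y $ i\<close> and \<open>y $ j\<close>. Solving for \<open>y $ i\<close> gives the quotient
  treated in \<open>fractional_linear_intervals\<close>.\<close>

lemma inv_entry_section:
  fixes g :: "'n :: {finite, linorder} \<times> 'n \<Rightarrow> real"
  assumes "0 < u"
  shows "\<exists>a b. {x. u \<le> \<bar>inv_entry (sym_mat (g((min i j, max i j) := x))) i j\<bar>}
    \<subseteq> {a..a + 1 / u} \<union> {b..b + 1 / u}"
proof -
  define S where "S x = sym_mat (g((min i j, max i j) := x))" for x
  show ?thesis
  proof (cases "\<exists>x'. det (S x') \<noteq> 0")
    case False
    \<comment> \<open>All these matrices are singular, so \<open>inv_entry\<close> takes its default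
      value 0, below \<open>u\<close>.\<close>
    then have "{x. u \<le> \<bar>inv_entry (S x) i j\<bar>} = {}"
      using \<open>0 < u\<close> by (auto simp: inv_entry_def)
    then show ?thesis unfolding S_def by auto
  next
    case True
    then obtain x' where x': "det (S x') \<noteq> 0" by blast
    define b where "b k = (\<chi> l. inv_entry (S x') l k)" for k
    have b: "S x' *v b k = axis k 1" for k
      unfolding b_def by (rule matrix_mult_inv_entry_column[OF x'])
    have symS: "transpose (S x) = S x" for x
      unfolding S_def by (rule transpose_sym_mat)
    define p q r where "p = b i $ i" and "q = b i $ j" and "r = b j $ j"
    have q: "b j $ i = q"
      using inner_symmetric_matrix[OF symS, of "b i" x' "b j"]
      by (simp add: b inner_axis inner_axis' q_def)
    have main: "u * \<bar>(1 + h * q)\<^sup>2 - h\<^sup>2 * (if i = j then 0 else p * r)\<bar>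
          \<le> \<bar>q - h * ((if i = j then 0 else p * r) - q\<^sup>2)\<bar>"
      if x: "u \<le> \<bar>inv_entry (S x) i j\<bar>" and h: "h = x - x'" for x h
    proof -
      have "det (S x) \<noteq> 0"
        using x \<open>0 < u\<close> by (auto simp: inv_entry_def)
      define y where "y = (\<chi> l. inv_entry (S x) l j)"
      have y: "S x *v y = axis j 1"
        unfolding y_def by (rule matrix_mult_inv_entry_column) fact
      have ui: "u \<le> \<bar>y $ i\<bar>" using x by (simp add: y_def)
      have E: "axis j 1 = S x' *v y + h *\<^sub>R
          (if i = j then y $ i *\<^sub>R axis i 1 else y $ j *\<^sub>R axis i 1 + y $ i *\<^sub>R axis j 1)"
        using sym_mat_fun_upd_mult[of g i j x y x'] by (simp only: S_def[symmetric] y h)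
      have eq: "b k $ j = y $ k + h * (if i = j then y $ i * b k $ i else y $ j * b k $ i + y $ i * b k $ j)" for k
      proof -
        have "inner (b k) (S x' *v y) = y $ k"
          unfolding inner_symmetric_matrix[OF symS] b by (simp add: inner_axis')
        then show ?thesis
          using arg_cong[OF E, of "inner (b k)"]
          by (cases "i = j") (simp_all add: inner_axis inner_add_right)
      qed
      have "y $ i * ((1 + h * q)\<^sup>2 - h\<^sup>2 * (if i = j then 0 else p * r))
          = q - h * ((if i = j then 0 else p * r) - q\<^sup>2)"
      proof (cases "i = j")
        case True
        then have e: "q = y $ i * (1 + h * q)"
          using eq[of i] by (simp add: q_def algebra_simps)
        \<comment> \<open>The rank-one relation is multiplied by \<open>1 + h * q\<close> to match
          the off-diagonal formula with \<open>p * r\<close> replaced by 0.\<close>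
        have "y $ i * (1 + h * q)\<^sup>2 = (y $ i * (1 + h * q)) * (1 + h * q)"
          by (simp add: power2_eq_square)
        also have "\<dots> = q * (1 + h * q)" using e by simp
        finally show ?thesis using True by (simp add: algebra_simps power2_eq_square)
      next
        case False
        have e1: "q = y $ i + h * (y $ j * p + y $ i * q)"
          using eq[of i] False by (simp add: p_def q_def)
        have e2: "r = y $ j + h * (y $ j * q + y $ i * r)"
          using eq[of j] False by (simp add: q r_def)
        \<comment> \<open>Eliminate \<open>y $ j\<close>: \<open>1 + h * q\<close> times
          \<open>e1\<close> minus \<open>h * p\<close> times \<open>e2\<close>.\<close>
        have "y $ i * ((1 + h * q)\<^sup>2 - h\<^sup>2 * (p * r)) = q - h * (p * r - q\<^sup>2)"
          using e1 e2 by algebra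
        then show ?thesis using False by simp
      qed
      then have "\<bar>y $ i\<bar> * \<bar>(1 + h * q)\<^sup>2 - h\<^sup>2 * (if i = j then 0 else p * r)\<bar>
          = \<bar>q - h * ((if i = j then 0 else p * r) - q\<^sup>2)\<bar>"
        by (metis abs_mult)
      then show ?thesis
        using mult_right_mono[OF ui, of "\<bar>(1 + h * q)\<^sup>2 - h\<^sup>2 * (if i = j then 0 else p * r)\<bar>"] by linarith
    qed
    obtain a c where ac: "{h. u * \<bar>(1 + h * q)\<^sup>2 - h\<^sup>2 * ((if i = j then 0 else p * r) * 1)\<bar>
        \<le> \<bar>q - h * ((if i = j then 0 else p * r) * 1 - q\<^sup>2)\<bar>}
      \<subseteq> {a..a + 1 / u} \<union> {c..c + 1 / u}"
      using fractional_linear_intervals[OF assms, of q "if i = j then 0 else p * r" 1] by blast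
    have "x \<in> {a + x'..a + x' + 1 / u} \<union> {c + x'..c + x' + 1 / u}"
      if "u \<le> \<bar>inv_entry (S x) i j\<bar>" for x
    proof -
      have "x - x' \<in> {a..a + 1 / u} \<union> {c..c + 1 / u}"
        using main[OF that refl] by (intro subsetD[OF ac]) simp
      then show ?thesis by auto
    qed
    then have "{x. u \<le> \<bar>inv_entry (S x) i j\<bar>}
        \<subseteq> {a + x'..a + x' + 1 / u} \<union> {c + x'..c + x' + 1 / u}"
      by (intro subsetI) simp
    then show ?thesis unfolding S_def by (intro exI)
  qed
qed

section \<open>Norm comparison and measurability\<close>

text \<open>The Frobenius norm dominates the spectral norm, by Cauchy-Schwarz in each row.\<close>

lemma onorm_square_le:
  fixes A :: "real^'n^'m"
  shows "(onorm ((*v) A))\<^sup>2 \<le> (\<Sum>i\<in>UNIV. \<Sum>j\<in>UNIV. (A $ i $ j)\<^sup>2)"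
proof -
  define s where "s = (\<Sum>i\<in>UNIV. \<Sum>j\<in>UNIV. (A $ i $ j)\<^sup>2)"
  have s: "0 \<le> s" by (auto simp: s_def intro!: sum_nonneg)
  have sq: "(norm v)\<^sup>2 = (\<Sum>i\<in>UNIV. (v $ i)\<^sup>2)" for v :: "real^'k"
    unfolding power2_norm_eq_inner inner_vec_def by (simp add: power2_eq_square)
  have "norm (A *v x) \<le> sqrt s * norm x" for x
  proof (rule power2_le_imp_le)
    have "(norm (A *v x))\<^sup>2 = (\<Sum>i\<in>UNIV. (inner (A $ i) x)\<^sup>2)"
      by (simp add: sq matrix_vector_mul_component)
    also have "\<dots> \<le> (\<Sum>i\<in>UNIV. (norm (A $ i) * norm x)\<^sup>2)"
      by (intro sum_mono) (metis Cauchy_Schwarz_ineq2 abs_ge_zero power2_abs power_mono)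
    also have "\<dots> = (sqrt s * norm x)\<^sup>2"
      using s by (simp add: power_mult_distrib s_def sum_distrib_right[symmetric]) (simp add: sq)
    finally show "(norm (A *v x))\<^sup>2 \<le> (sqrt s * norm x)\<^sup>2" .
  qed (use s in auto)
  then have "onorm ((*v) A) \<le> sqrt s"
    using s by (intro onorm_bound) auto
  moreover have "0 \<le> onorm ((*v) A)"
    by (rule onorm_pos_le) simp
  ultimately show ?thesis
    using s power_mono[of "onorm ((*v) A)" "sqrt s" 2] by (simp add: s_def)
qed

lemma borel_measurable_det:
  fixes A :: "'a \<Rightarrow> real^'n^'n"
  assumes [measurable]: "\<And>i j. (\<lambda>x. A x $ i $ j) \<in> borel_measurable N"
  shows "(\<lambda>x. det (A x)) \<in> borel_measurable N"
  unfolding det_def by measurable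

lemma borel_measurable_inv_entry:
  fixes A :: "'a \<Rightarrow> real^'n^'n"
  assumes [measurable]: "\<And>i j. (\<lambda>x. A x $ i $ j) \<in> borel_measurable N"
  shows "(\<lambda>x. inv_entry (A x) i j) \<in> borel_measurable N"
  unfolding inv_entry_def by (intro borel_measurable_divide borel_measurable_det) simp_all

lemma borel_measurable_sym_mat:
  "(\<lambda>g. sym_mat g $ i $ j) \<in> borel_measurable (PiM {(i, j). i \<le> j} (\<lambda>_. borel))"
  unfolding sym_mat_def by (simp add: measurable_component_singleton min_le_iff_disj)

section \<open>Almost sure invertibility\<close>

text \<open>The principal minor of \<^term>\<open>sym_mat g\<close> on \<open>S\<close>, written as a determinant of full size.\<close>

definition partial_det :: "('n :: {finite, linorder}) set \<Rightarrow> ('n \<times> 'n \<Rightarrow> real) \<Rightarrow> real" where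
  "partial_det S g = det (\<chi> i. if i \<in> S then sym_mat g $ i else axis i 1)"

lemma partial_det_empty: "partial_det {} g = 1"
proof -
  have "(\<chi> i. if i \<in> {} then sym_mat g $ i else axis i 1) = mat 1"
    by (simp add: vec_eq_iff mat_def axis_def)
  then show ?thesis by (simp only: partial_det_def det_I)
qed

lemma partial_det_UNIV: "partial_det UNIV g = det (sym_mat g)"
  by (simp add: partial_det_def)

text \<open>The two matrices differ only in row \<open>i\<close>, by \<open>(x - x')\<close> times a
  unit vector; with that unit vector as row \<open>i\<close> the determinant is
  \<open>partial_det S g\<close>.\<close>

lemma partial_det_insert_diff:
  assumes "i \<notin> S"
  shows "partial_det (insert i S) (g((i, i) := x)) - partial_det (insert i S) (g((i, i) := x'))
    = (x - x') * partial_det S g"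
proof -
  define c where "c k = (if k \<in> S then sym_mat g $ k else axis k 1)" for k
  define a where "a x = sym_mat (g((i, i) := x)) $ i" for x
  have upd: "sym_mat (g((i, i) := x)) $ k $ l = (if k = i \<and> l = i then x else sym_mat g $ k $ l)" for x k l
    using sym_mat_fun_upd[of g i i] by simp
  have D: "partial_det (insert i S) (g((i, i) := x)) = det (\<chi> k. if k = i then a x else c k)" for x
    unfolding partial_det_def
    by (intro arg_cong[where f=det]) (auto simp: vec_eq_iff upd a_def c_def)
  have ax: "a x = a x' + (x - x') *s axis i 1"
    by (auto simp: vec_eq_iff a_def upd axis_def)
  have "partial_det (insert i S) (g((i, i) := x)) =
      det (\<chi> k. if k = i then a x' + (x - x') *s axis i 1 else c k)"
    by (simp only: D ax[symmetric])
  also have "\<dots> = det (\<chi> k. if k = i then a x' else c k)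
      + (x - x') * det (\<chi> k. if k = i then axis i 1 else c k)"
    by (subst det_row_add, subst det_row_mul) simp
  also have "(\<chi> k. if k = i then axis i 1 else c k) = (\<chi> k. if k \<in> S then sym_mat g $ k else axis k 1)"
    using assms by (auto simp: vec_eq_iff c_def)
  finally show ?thesis unfolding D[symmetric] partial_det_def[symmetric] by linarith
qed

text \<open>Induction on \<open>S\<close>: where the minor on \<open>S\<close> is nonzero, the next
  one is affine with nonzero slope in the new diagonal entry, so it vanishes for at most one value,
  which has Lebesgue measure 0.\<close>

lemma (in prob_space) det_sym_mat_nonzero:
  fixes X :: "'n :: {finite, linorder} \<times> 'n \<Rightarrow> 'a \<Rightarrow> real"
  defines "I \<equiv> {(i, j). i \<le> j}"
  assumes ind: "indep_vars (\<lambda>_. borel) X I"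
    and dens: "\<And>k. k \<in> I \<Longrightarrow> has_density_bounded_by M (X k) K"
  shows "emeasure M {\<omega> \<in> space M. det (sym_mat (\<lambda>k\<in>I. X k \<omega>)) = 0} = 0"
proof -
  have [measurable]: "partial_det S \<in> borel_measurable (PiM I (\<lambda>_. borel))" for S
    unfolding partial_det_def I_def
  proof (rule borel_measurable_det)
    fix i j
    show "(\<lambda>g. (\<chi> i. if i \<in> S then sym_mat g $ i else axis i 1) $ i $ j)
        \<in> borel_measurable (PiM {(i, j). i \<le> j} (\<lambda>_. borel))"
      using borel_measurable_sym_mat[of i j] by (cases "i \<in> S") simp_all
  qed
  have [measurable]: "(\<lambda>\<omega>. \<lambda>k\<in>I. X k \<omega>) \<in> measurable M (PiM I (\<lambda>_. borel))"
    using ind by (intro measurable_restrict) (simp add: indep_vars_def)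
  have "emeasure M {\<omega> \<in> space M. partial_det S (\<lambda>k\<in>I. X k \<omega>) = 0} = 0" for S
    using finite[of S]
  proof (induction S)
    case empty
    then show ?case by (simp add: partial_det_empty)
  next
    case (insert i S)
    define Q where "Q g \<longleftrightarrow> partial_det S g \<noteq> 0 \<and> partial_det (insert i S) g = 0" for g
    have ii: "(i, i) \<in> I" by (simp add: I_def)
    have "emeasure M {\<omega> \<in> space M. Q (\<lambda>k\<in>I. X k \<omega>)} \<le> ennreal K * 0"
    proof (rule indep_vars_section_bound[OF ind _ ii dens[OF ii]])
      show "Measurable.pred (PiM I (\<lambda>_. borel)) Q"
        unfolding Q_def by measurable
      fix g
      have "\<exists>x'. {x. Q (g((i, i) := x))} \<subseteq> {x'}"
      proof (cases "\<exists>x'. Q (g((i, i) := x'))")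
        case True
        then obtain x' where x': "Q (g((i, i) := x'))" by blast
        \<comment> \<open>The slope is evaluated at \<open>g((i, i) := x)\<close>, where
          \<open>Q\<close> says that it is nonzero.\<close>
        have "x = x'" if x: "Q (g((i, i) := x))" for x
          using x x' partial_det_insert_diff[OF insert(2), of "g((i, i) := x)" x x']
          by (simp add: Q_def)
        then show ?thesis by blast
      qed auto
      then show "\<exists>V\<in>sets lborel. {x. Q (g((i, i) := x))} \<subseteq> V \<and> emeasure lborel V \<le> 0"
        by (metis borel_closed closed_singleton emeasure_lborel_singleton order_refl sets_lborel)
    qed simp
    then have "{\<omega> \<in> space M. Q (\<lambda>k\<in>I. X k \<omega>)} \<in> null_sets M"
      unfolding Q_def by (intro null_setsI) (auto, measurable)
    moreover have "{\<omega> \<in> space M. partial_det S (\<lambda>k\<in>I. X k \<omega>) = 0} \<in> null_sets M"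
      by (intro null_setsI insert.IH) measurable
    ultimately have "{\<omega> \<in> space M. Q (\<lambda>k\<in>I. X k \<omega>)}
        \<union> {\<omega> \<in> space M. partial_det S (\<lambda>k\<in>I. X k \<omega>) = 0} \<in> null_sets M"
      by auto
    then have "{\<omega> \<in> space M. partial_det (insert i S) (\<lambda>k\<in>I. X k \<omega>) = 0} \<in> null_sets M"
      by (rule null_sets_subset) (auto simp: Q_def)
    then show ?case by (rule null_setsD1)
  qed
  from this[of UNIV] show ?thesis by (simp add: partial_det_UNIV)
qed

section \<open>Tail of one inverse entry, and the norm bound\<close>

lemma (in prob_space) inv_entry_sym_mat_tail:
  fixes X :: "'n :: {finite, linorder} \<times> 'n \<Rightarrow> 'a \<Rightarrow> real"
  defines "I \<equiv> {(i, j). i \<le> j}"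
  assumes ind: "indep_vars (\<lambda>_. borel) X I"
    and dens: "\<And>k. k \<in> I \<Longrightarrow> has_density_bounded_by M (X k) K"
    and "0 < u"
  shows "emeasure M {\<omega> \<in> space M. u \<le> \<bar>inv_entry (sym_mat (\<lambda>k\<in>I. X k \<omega>)) i j\<bar>} \<le> ennreal (2 * K / u)"
proof -
  have [measurable]: "(\<lambda>g. inv_entry (sym_mat g) i j) \<in> borel_measurable (PiM I (\<lambda>_. borel))"
    unfolding I_def by (intro borel_measurable_inv_entry borel_measurable_sym_mat)
  have k: "(min i j, max i j) \<in> I" by (simp add: I_def min_le_iff_disj)
  have "emeasure M {\<omega> \<in> space M. u \<le> \<bar>inv_entry (sym_mat (\<lambda>k\<in>I. X k \<omega>)) i j\<bar>}
      \<le> ennreal K * ennreal (2 / u)"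
  proof (rule indep_vars_section_bound[OF ind _ k dens[OF k]])
    fix g
    obtain a b where ab: "{x. u \<le> \<bar>inv_entry (sym_mat (g((min i j, max i j) := x))) i j\<bar>}
        \<subseteq> {a..a + 1 / u} \<union> {b..b + 1 / u}"
      using inv_entry_section[OF \<open>0 < u\<close>] by blast
    have "emeasure lborel ({a..a + 1 / u} \<union> {b..b + 1 / u})
        \<le> emeasure lborel {a..a + 1 / u} + emeasure lborel {b..b + 1 / u}"
      by (intro emeasure_subadditive) auto
    also have "\<dots> = ennreal (2 / u)"
      using \<open>0 < u\<close> by (simp add: ennreal_plus[symmetric] del: ennreal_plus)
    finally show "\<exists>V\<in>sets lborel.
        {x. u \<le> \<bar>inv_entry (sym_mat (g((min i j, max i j) := x))) i j\<bar>} \<subseteq> V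
        \<and> emeasure lborel V \<le> ennreal (2 / u)"
      using ab by (intro bexI[where x="{a..a + 1 / u} \<union> {b..b + 1 / u}"]) auto
  qed (simp, measurable)
  also have "\<dots> = ennreal (2 * K / u)"
    using density_bound_pos[OF dens[OF k]] \<open>0 < u\<close>
    by (simp add: ennreal_mult[symmetric] mult.commute)
  finally show ?thesis .
qed

theorem theorem1p1:
  fixes M :: "'a measure"
    and A :: "'a \<Rightarrow> real ^ ('n :: {finite, linorder}) ^ ('n :: {finite, linorder})"
    and K :: real
  assumes "prob_space M"
    and "A \<in> borel_measurable M"
    and "\<And>\<omega>. \<omega> \<in> space M \<Longrightarrow> transpose (A \<omega>) = A \<omega>"
    and "prob_space.indep_vars M (\<lambda>_. borel) (\<lambda>(i, j) \<omega>. A \<omega> $ i $ j) {(i, j). i \<le> j}"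
    and "\<And>i j. i \<le> j \<Longrightarrow> has_density_bounded_by M (\<lambda>\<omega>. A \<omega> $ i $ j) K"
  shows "\<forall>t::real. t > 0 \<longrightarrow>
    \<P>(\<omega> in M. onorm ((*v) (matrix_inv (A \<omega>))) \<ge> (real CARD('n))\<^sup>2 * t) \<le> 8 * K / t"
proof (intro allI impI)
  fix t :: real
  assume "0 < t"
  interpret prob_space M by fact
  define I :: "('n \<times> 'n) set" where "I = {(i, j). i \<le> j}"
  define X where "X = (\<lambda>(i, j) \<omega>. A \<omega> $ i $ j)"
  have ind: "indep_vars (\<lambda>_. borel) X I"
    using assms(4) unfolding X_def I_def .
  have dens: "has_density_bounded_by M (X k) K" if "k \<in> I" for k
    using assms(5) that by (auto simp: X_def I_def)
  have "K > 0"
    using assms(5)[OF order_refl] by (rule density_bound_pos)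
  have A: "sym_mat (\<lambda>k\<in>I. X k \<omega>) = A \<omega>" if "\<omega> \<in> space M" for \<omega>
  proof -
    have "A \<omega> $ j $ i = A \<omega> $ i $ j" for i j
      by (subst (2) assms(3)[OF that, symmetric]) (simp add: transpose_def)
    then show ?thesis
      by (auto simp: sym_mat_def I_def X_def vec_eq_iff min_def max_def)
  qed
  have rvX: "(\<lambda>\<omega>. \<lambda>k\<in>I. X k \<omega>) \<in> measurable M (PiM I (\<lambda>_. borel))"
    using ind by (intro measurable_restrict) (simp add: indep_vars_def)
  have [measurable]: "(\<lambda>\<omega>. A \<omega> $ i $ j) \<in> borel_measurable M" for i j
    using measurable_compose[OF rvX, OF borel_measurable_sym_mat[of i j, folded I_def]]
    by (simp add: A cong: measurable_cong)
  have [measurable]: "(\<lambda>\<omega>. inv_entry (A \<omega>) i j) \<in> borel_measurable M" for i j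
    by (intro borel_measurable_inv_entry) measurable
  have [measurable]: "(\<lambda>\<omega>. det (A \<omega>)) \<in> borel_measurable M"
    by (intro borel_measurable_det) measurable
  define c where "c = (real CARD('n))\<^sup>2 * t"
  have "0 < c" using \<open>0 < t\<close> by (simp add: c_def)
  \<comment> \<open>Truncating at the threshold \<open>c\<close> itself keeps the second moments
    finite and, as shown below, loses nothing of the event.\<close>
  define F where "F \<omega> = (\<Sum>i\<in>UNIV. \<Sum>j\<in>UNIV. (min \<bar>inv_entry (A \<omega>) i j\<bar> c)\<^sup>2)" for \<omega>
  have [measurable]: "F \<in> borel_measurable M" unfolding F_def by measurable
  define B where "B = {\<omega> \<in> space M. c\<^sup>2 \<le> F \<omega>}"
  define Z where "Z = {\<omega> \<in> space M. det (A \<omega>) = 0}"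
  have [measurable]: "B \<in> sets M" "Z \<in> sets M"
    unfolding B_def Z_def by measurable
  have "emeasure M Z = 0"
    using det_sym_mat_nonzero[OF ind[unfolded I_def] dens[unfolded I_def]]
    by (simp add: Z_def A[unfolded I_def] cong: conj_cong)
  have mom: "(\<integral>\<^sup>+\<omega>. ennreal ((min \<bar>inv_entry (A \<omega>) i j\<bar> c)\<^sup>2) \<partial>M) \<le> ennreal (2 * (2 * K) * c)" for i j
  proof (rule truncated_second_moment_le)
    fix u :: real assume "0 < u"
    then show "emeasure M {\<omega> \<in> space M. u \<le> \<bar>inv_entry (A \<omega>) i j\<bar>} \<le> ennreal (2 * K / u)"
      using inv_entry_sym_mat_tail[OF ind[unfolded I_def] dens[unfolded I_def], of u i j]
      by (simp add: A[unfolded I_def] cong: conj_cong)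
  qed (use \<open>0 < K\<close> \<open>0 < c\<close> in auto)
  \<comment> \<open>Markov's inequality for \<open>F\<close> at level \<open>c^2\<close>.\<close>
  have "ennreal (c\<^sup>2 * measure M B) = ennreal (c\<^sup>2) * emeasure M B"
    by (simp add: emeasure_eq_measure ennreal_mult)
  also have "\<dots> = (\<integral>\<^sup>+\<omega>. ennreal (c\<^sup>2) * indicator B \<omega> \<partial>M)"
    by (simp add: nn_integral_cmult_indicator)
  also have "\<dots> \<le> (\<integral>\<^sup>+\<omega>. ennreal (F \<omega>) \<partial>M)"
    by (intro nn_integral_mono) (auto simp: B_def indicator_def intro: ennreal_leI)
  also have "\<dots> = (\<integral>\<^sup>+\<omega>. (\<Sum>i\<in>UNIV. \<Sum>j\<in>UNIV. ennreal ((min \<bar>inv_entry (A \<omega>) i j\<bar> c)\<^sup>2)) \<partial>M)"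
    unfolding F_def by (intro nn_integral_cong) (simp add: sum_ennreal sum_nonneg)
  also have "\<dots> = (\<Sum>i\<in>UNIV. \<Sum>j\<in>UNIV. \<integral>\<^sup>+\<omega>. ennreal ((min \<bar>inv_entry (A \<omega>) i j\<bar> c)\<^sup>2) \<partial>M)"
    by (simp add: nn_integral_sum del: sum_ennreal)
  also have "\<dots> \<le> (\<Sum>i\<in>(UNIV::'n set). \<Sum>j\<in>(UNIV::'n set). ennreal (2 * (2 * K) * c))"
    by (intro sum_mono mom)
  also have "\<dots> = ennreal ((real CARD('n))\<^sup>2 * (4 * K * c))"
    using \<open>0 < K\<close> \<open>0 < c\<close>
    by (subst sum_ennreal, simp, subst sum_ennreal)
      (auto simp: power2_eq_square mult_ac intro!: sum_nonneg)
  finally have "c\<^sup>2 * measure M B \<le> (real CARD('n))\<^sup>2 * (4 * K * c)"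
    using \<open>0 < K\<close> \<open>0 < c\<close> by (subst (asm) ennreal_le_iff) auto
  \<comment> \<open>The number of entries is \<open>c / t\<close>, which supplies the second factor
    \<open>c\<close>.\<close>
  also have "\<dots> = c\<^sup>2 * (4 * K / t)"
    using \<open>0 < t\<close> by (simp add: c_def power2_eq_square field_simps)
  finally have "measure M B \<le> 4 * K / t"
    using \<open>0 < c\<close> by (simp only: mult_le_cancel_left_pos zero_less_power)
  moreover have "4 * K / t \<le> 8 * K / t"
    using \<open>0 < K\<close> \<open>0 < t\<close> by (simp add: field_simps)
  \<comment> \<open>Monotonicity asks measurability only of \<open>B \<union> Z\<close>; the set
    \<open>Z\<close> absorbs the singular matrices, where \<open>matrix_inv\<close> is
    unspecified.\<close>
  moreover have "measure M {\<omega> \<in> space M. onorm ((*v) (matrix_inv (A \<omega>))) \<ge> c} \<le> measure M (B \<union> Z)"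
  proof (intro finite_measure_mono subsetI)
    fix \<omega> assume \<omega>: "\<omega> \<in> {\<omega> \<in> space M. onorm ((*v) (matrix_inv (A \<omega>))) \<ge> c}"
    show "\<omega> \<in> B \<union> Z"
    proof (cases "det (A \<omega>) = 0")
      case False
      have "c\<^sup>2 \<le> (onorm ((*v) (matrix_inv (A \<omega>))))\<^sup>2"
        using \<omega> \<open>0 < c\<close> by (intro power_mono) auto
      also have "\<dots> \<le> (\<Sum>i\<in>UNIV. \<Sum>j\<in>UNIV. (inv_entry (A \<omega>) i j)\<^sup>2)"
        using onorm_square_le[of "matrix_inv (A \<omega>)"] by (simp add: matrix_inv_eq_inv_entry[OF False])
      finally have sum: "c\<^sup>2 \<le> (\<Sum>i\<in>UNIV. \<Sum>j\<in>UNIV. (inv_entry (A \<omega>) i j)\<^sup>2)" .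
      have "c\<^sup>2 \<le> F \<omega>"
      \<comment> \<open>An entry reaching \<open>c\<close> contributes \<open>c^2\<close> to
        \<open>F\<close> on its own; otherwise no entry is truncated.\<close>
      proof (cases "\<exists>i j. c \<le> \<bar>inv_entry (A \<omega>) i j\<bar>")
        case True
        then obtain i j where "c \<le> \<bar>inv_entry (A \<omega>) i j\<bar>" by blast
        then have "c\<^sup>2 = (min \<bar>inv_entry (A \<omega>) i j\<bar> c)\<^sup>2" by (simp add: min_def)
        also have "\<dots> \<le> (\<Sum>j\<in>UNIV. (min \<bar>inv_entry (A \<omega>) i j\<bar> c)\<^sup>2)"
          by (rule member_le_sum) auto
        also have "\<dots> \<le> F \<omega>"
          unfolding F_def by (rule member_le_sum) (auto intro!: sum_nonneg)
        finally show ?thesis .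
      next
        case False
        then have "min \<bar>inv_entry (A \<omega>) i j\<bar> c = \<bar>inv_entry (A \<omega>) i j\<bar>" for i j
          by (intro min_absorb1) (meson linear)
        then show ?thesis using sum by (simp add: F_def)
      qed
      then show ?thesis using \<omega> by (simp add: B_def)
    qed (use \<omega> in \<open>simp add: Z_def\<close>)
  qed measurable
  moreover have "measure M (B \<union> Z) \<le> measure M B + measure M Z"
    by (rule measure_Un_le) measurable
  moreover have "measure M Z = 0"
    using \<open>emeasure M Z = 0\<close> by (simp add: measure_def)
  ultimately show "\<P>(\<omega> in M. onorm ((*v) (matrix_inv (A \<omega>))) \<ge> (real CARD('n))\<^sup>2 * t) \<le> 8 * K / t"
    unfolding c_def by linarith
qed

end
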